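(* Let $k_1,k_2,k_3\in\mathbb{R}$. For $a\ne0$ and $x_0\in\mathbb{R}$, the equation $$m_t+k_1[(u^2-u_x^2)m]_x+k_2(u^2m_x+3uu_xm)+k_3(um_x+2u_xm)=0,\qquad m=u-u_{xx},\quad x\in\mathbb{R},\ t>0,$$ admits a global weak peakon solution (in the sense defined in the context) of the form $$u_a(t,x)=a\,e^{-|x-ct-x_0|},$$ with the velocity $c$ satisfying $$c=\left(\frac{2k_1}{3}+k_2\right)a^2+k_3a.$$
   Context: Let $p(x)=\frac12e^{-|x|}$ and let $*$ denote convolution in $x$. For $u_0\in W^{1,3}(\mathbb{R})$, a function $u\in L^\infty_{loc}([0,T),W^{1,3}_{loc}(\mathbb{R}))$ is a weak solution of the equation with initial datum $u_0$ if $$\begin{aligned}&\int_0^T\!\!\int_{\mathbb{R}}\Big\{u\varphi_t+\tfrac{k_1+k_2}{3}u^3\varphi_x+\tfrac{k_1}{3}u_x^3\varphi+\tfrac{k_3}{2}u^2\varphi_x-p*\big[(\tfrac{k_1}{3}+\tfrac{k_2}{2})u_x^3\big]\varphi\\&\quad+p*\big[(\tfrac{2k_1}{3}+k_2)u^3+(k_1+\tfrac{3k_2}{2})uu_x^2+k_3u^2+\tfrac{k_3}{2}u_x^2\big]\varphi_x\Big\}dx\,dt+\int_{\mathbb{R}}u_0(x)\varphi(0,x)\,dx=0\end{aligned}$$ for every smooth test function $\varphi\in C_c^\infty([0,T)\times\mathbb{R})$. It is a global weak solution if $T$ can be taken arbitrarily large. *)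

theory Defs
  imports "HOL-Analysis.Analysis"
begin

section \<open>Test functions\<close>

text \<open>In finite dimensions this is the usual class of \<open>k\<close> times continuously differentiable functions:
  all directional derivatives are required to lie in the class one order lower.\<close>

primrec Ck :: "nat \<Rightarrow> ('a::real_normed_vector \<Rightarrow> real) \<Rightarrow> bool" where
  "Ck 0 f \<longleftrightarrow> continuous_on UNIV f"
| "Ck (Suc k) f \<longleftrightarrow>
     (\<forall>x. f differentiable (at x)) \<and> (\<forall>v. Ck k (\<lambda>x. frechet_derivative f (at x) v))"

text \<open>Smooth functions whose support relative to \<open>S\<close> is a compact subset of \<open>S\<close>. Elements are functions
  on the whole space of which only the restriction to \<open>S\<close> matters. For \<open>S = [0,T) \<times> \<real>\<close> they are
  smooth up to \<open>t = 0\<close> and need not vanish there, but they vanish for \<open>t\<close> near \<open>T\<close>.\<close>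

definition Cc_infinity :: "'a::real_normed_vector set \<Rightarrow> ('a \<Rightarrow> real) set" where
  "Cc_infinity S =
     {\<phi>. (\<forall>k. Ck k \<phi>) \<and> (\<exists>K. compact K \<and> K \<subseteq> S \<and> (\<forall>z \<in> S - K. \<phi> z = 0))}"


section \<open>Sobolev spaces\<close>

definition L3_on :: "real set \<Rightarrow> (real \<Rightarrow> real) \<Rightarrow> bool" where
  "L3_on S f \<longleftrightarrow> f \<in> borel_measurable (lebesgue_on S) \<and> integrable (lebesgue_on S) (\<lambda>x. \<bar>f x\<bar> ^ 3)"

definition weak_deriv :: "(real \<Rightarrow> real) \<Rightarrow> (real \<Rightarrow> real) \<Rightarrow> bool" where
  "weak_deriv f g \<longleftrightarrow>
     (\<forall>K. compact K \<longrightarrow> f absolutely_integrable_on K \<and> g absolutely_integrable_on K) \<and>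
     (\<forall>\<phi> \<in> Cc_infinity UNIV.
        (LINT x|lebesgue. f x * deriv \<phi> x) = - (LINT x|lebesgue. g x * \<phi> x))"

definition W13 :: "(real \<Rightarrow> real) \<Rightarrow> bool" where
  "W13 f \<longleftrightarrow> (\<exists>g. weak_deriv f g \<and> L3_on UNIV f \<and> L3_on UNIV g)"

text \<open>\<open>u\<close> lies in \<open>L\<^sup>\<infinity>\<^sub>l\<^sub>o\<^sub>c([0,T), W\<^sup>1\<^sup>,\<^sup>3\<^sub>l\<^sub>o\<^sub>c(\<real>))\<close>, with weak spatial derivative \<open>ux\<close>. Measurability in time is
  expressed as joint Lebesgue measurability of \<open>u\<close> and \<open>ux\<close>; the local norms are essentially
  bounded on compact subintervals of \<open>[0,T)\<close>.\<close>

definition Linf_loc_W13_loc ::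
  "real \<Rightarrow> (real \<Rightarrow> real \<Rightarrow> real) \<Rightarrow> (real \<Rightarrow> real \<Rightarrow> real) \<Rightarrow> bool" where
  "Linf_loc_W13_loc T u ux \<longleftrightarrow>
     (\<lambda>(t, x). u t x) \<in> borel_measurable (lebesgue_on ({0..<T} \<times> UNIV)) \<and>
     (\<lambda>(t, x). ux t x) \<in> borel_measurable (lebesgue_on ({0..<T} \<times> UNIV)) \<and>
     (AE t in lebesgue_on {0..<T}. weak_deriv (u t) (ux t)) \<and>
     (\<forall>T' K. 0 \<le> T' \<and> T' < T \<and> compact K \<longrightarrow>
        (\<exists>M. AE t in lebesgue_on {0..T'}.
           L3_on K (u t) \<and> L3_on K (ux t) \<and>
           (LINT x|lebesgue_on K. \<bar>u t x\<bar> ^ 3 + \<bar>ux t x\<bar> ^ 3) \<le> M))"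


section \<open>Weak solutions\<close>

definition p :: "real \<Rightarrow> real" where
  "p x = exp (- \<bar>x\<bar>) / 2"

definition conv_exists :: "(real \<Rightarrow> real) \<Rightarrow> (real \<Rightarrow> real) \<Rightarrow> bool" where
  "conv_exists f g \<longleftrightarrow> (\<forall>x. integrable lebesgue (\<lambda>y. f (x - y) * g y))"

definition conv :: "(real \<Rightarrow> real) \<Rightarrow> (real \<Rightarrow> real) \<Rightarrow> real \<Rightarrow> real" where
  "conv f g x = (LINT y|lebesgue. f (x - y) * g y)"

text \<open>The two expressions convolved with \<^const>\<open>p\<close>, as functions of the values of \<open>u\<close> and \<open>u\<^sub>x\<close>.\<close>

definition source0 :: "real \<Rightarrow> real \<Rightarrow> real \<Rightarrow> real" where
  "source0 k1 k2 v = (k1 / 3 + k2 / 2) * v ^ 3"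

definition source1 :: "real \<Rightarrow> real \<Rightarrow> real \<Rightarrow> real \<Rightarrow> real \<Rightarrow> real" where
  "source1 k1 k2 k3 w v =
     (2 * k1 / 3 + k2) * w ^ 3 + (k1 + 3 * k2 / 2) * w * v\<^sup>2 + k3 * w\<^sup>2 + k3 / 2 * v\<^sup>2"

definition weak_integrand ::
  "real \<Rightarrow> real \<Rightarrow> real \<Rightarrow> (real \<Rightarrow> real \<Rightarrow> real) \<Rightarrow> (real \<Rightarrow> real \<Rightarrow> real) \<Rightarrow>
   (real \<times> real \<Rightarrow> real) \<Rightarrow> real \<Rightarrow> real \<Rightarrow> real" where
  "weak_integrand k1 k2 k3 u ux \<phi> t x =
    (let \<phi>t = deriv (\<lambda>s. \<phi> (s, x)) t;
         \<phi>x = deriv (\<lambda>y. \<phi> (t, y)) x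
     in u t x * \<phi>t
        + (k1 + k2) / 3 * u t x ^ 3 * \<phi>x
        + k1 / 3 * ux t x ^ 3 * \<phi> (t, x)
        + k3 / 2 * (u t x)\<^sup>2 * \<phi>x
        - conv p (\<lambda>y. source0 k1 k2 (ux t y)) x * \<phi> (t, x)
        + conv p (\<lambda>y. source1 k1 k2 k3 (u t y) (ux t y)) x * \<phi>x)"

text \<open>Membership in \<open>L\<^sup>\<infinity>\<^sub>l\<^sub>o\<^sub>c([0,T), W\<^sup>1\<^sup>,\<^sup>3\<^sub>l\<^sub>o\<^sub>c(\<real>))\<close> does not by itself make the (nonlocal) convolutions converge, and
  the Bochner integral of a non-integrable function is 0 by convention. Hence the existence of all
  integrals in the weak identity is demanded explicitly.\<close>

definition weak_solution ::
  "real \<Rightarrow> real \<Rightarrow> real \<Rightarrow> real \<Rightarrow> (real \<Rightarrow> real) \<Rightarrow> (real \<Rightarrow> real \<Rightarrow> real) \<Rightarrow> bool" where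
  "weak_solution k1 k2 k3 T u0 u \<longleftrightarrow>
     W13 u0 \<and>
     (\<exists>ux. Linf_loc_W13_loc T u ux \<and>
        (AE t in lebesgue_on {0..<T}.
           conv_exists p (\<lambda>y. source0 k1 k2 (ux t y)) \<and>
           conv_exists p (\<lambda>y. source1 k1 k2 k3 (u t y) (ux t y))) \<and>
        (\<forall>\<phi> \<in> Cc_infinity ({0..<T} \<times> UNIV).
           integrable (lebesgue_on ({0..<T} \<times> UNIV)) (\<lambda>(t, x). weak_integrand k1 k2 k3 u ux \<phi> t x) \<and>
           (LINT t|lebesgue_on {0..<T}. LINT x|lebesgue. weak_integrand k1 k2 k3 u ux \<phi> t x)
             + (LINT x|lebesgue. u0 x * \<phi> (0, x)) = 0))"

definition global_weak_solution ::
  "real \<Rightarrow> real \<Rightarrow> real \<Rightarrow> (real \<Rightarrow> real) \<Rightarrow> (real \<Rightarrow> real \<Rightarrow> real) \<Rightarrow> bool" where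
  "global_weak_solution k1 k2 k3 u0 u \<longleftrightarrow> (\<forall>T>0. weak_solution k1 k2 k3 T u0 u)"

definition peakon :: "real \<Rightarrow> real \<Rightarrow> real \<Rightarrow> real \<Rightarrow> real \<Rightarrow> real" where
  "peakon a c x0 t x = a * exp (- \<bar>x - c * t - x0\<bar>)"

end

theory Submission
  imports Defs "HOL-Real_Asymp.Real_Asymp"
begin

text \<open>
  Write \<open>s = c * t + x0\<close> for the position of the crest and \<open>e(x) = exp (- \<bar>x - s\<bar>)\<close> for the profile, so
  that \<open>u = a * e\<close> and \<open>u\<^sub>x = - sgn (x - s) * a * e\<close>. Away from the
  crest, the functions convolved with \<open>p\<close> are combinations of \<open>e\<^sup>2\<close>, \<open>e\<^sup>3\<close> and \<open>sgn (x - s) * e\<^sup>3\<close>. Since \<open>p\<close> is the fundamental solution of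
  \<open>1 - d\<^sup>2/dx\<^sup>2\<close>, their convolutions are read off from explicit solutions of \<open>w - w'' = h\<close> which are \<open>C\<^sup>1\<close>
  across the crest (\<open>conv_p_fundamental_solution\<close>, \<open>conv_p_even\<close>, \<open>conv_p_odd\<close>).

  Inserting them, the integrand of the weak identity becomes
  \<open>a * e * (\<phi>\<^sub>t + c * \<phi>\<^sub>x) + (G * \<phi>)\<^sub>x\<close> with \<open>G\<close> a combination of \<open>e\<^sup>3\<close> and \<open>e\<close>
  (\<open>weak_integrand_peakon\<close>). This form is where the relation between speed and amplitude is used.
  The derivative \<open>(G * \<phi>)\<^sub>x\<close> integrates to zero because \<open>G\<close> is continuous at the crest
  (\<open>integration_by_parts_kink\<close>), and what remains is the weak form of the transport equation, solved by
  every travelling profile (\<open>cusp_travelling_weak_transport\<close>).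
\<close>

section \<open>The peaked profile\<close>

definition cusp :: "real \<Rightarrow> real \<Rightarrow> real" where
  "cusp s x = exp (- \<bar>x - s\<bar>)"

lemma cusp_ge_0 [simp]: "0 \<le> cusp s x" and cusp_le_1 [simp]: "cusp s x \<le> 1"
  by (simp_all add: cusp_def)

lemma continuous_cusp [continuous_intros]: "continuous_on S (cusp s)"
  unfolding cusp_def by (intro continuous_intros)

lemma borel_measurable_cusp [measurable]: "cusp s \<in> borel_measurable borel"
  by (intro borel_measurable_continuous_onI continuous_cusp)

lemma cusp_deriv:
  assumes "x \<noteq> s"
  shows "(cusp s has_real_derivative - sgn (x - s) * cusp s x) (at x)"
proof (cases "x < s")
  case True
  have "((\<lambda>x. exp (x - s)) has_real_derivative exp (x - s)) (at x)"
    by (auto intro!: derivative_eq_intros)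
  then have "(cusp s has_real_derivative exp (x - s)) (at x)"
    by (rule has_field_derivative_transform_within_open[where S="{..<s}"]) (use True in \<open>auto simp: cusp_def\<close>)
  then show ?thesis using True by (simp add: cusp_def)
next
  case False
  then have gt: "s < x" using assms by simp
  have "((\<lambda>x. exp (s - x)) has_real_derivative - exp (s - x)) (at x)"
    by (auto intro!: derivative_eq_intros)
  then have "(cusp s has_real_derivative - exp (s - x)) (at x)"
    by (rule has_field_derivative_transform_within_open[where S="{s<..}"]) (use gt in \<open>auto simp: cusp_def\<close>)
  then show ?thesis using gt by (simp add: cusp_def)
qed

lemma sgn_deriv:
  fixes s x :: real
  assumes "x \<noteq> s"
  shows "((\<lambda>x. sgn (x - s)) has_real_derivative 0) (at x)"
proof (rule has_field_derivative_transform_within_open)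
  show "((\<lambda>_. sgn (x - s)) has_real_derivative 0) (at x)" by simp
  show "open (if x < s then {..<s} else {s<..})" by simp
qed (use assms in \<open>auto split: if_splits\<close>)

text \<open>Where a jump of the sign meets a zero of the other factor, continuity survives. This is what makes
  the potentials of the source terms below continuously differentiable across the crest.\<close>

lemma continuous_on_sgn_mult:
  fixes k :: "real \<Rightarrow> real"
  assumes "continuous_on UNIV k" "k s = 0"
  shows "continuous_on UNIV (\<lambda>x. sgn (x - s) * k x)"
proof -
  have "continuous_on ({..s} \<union> {s..}) (\<lambda>x. if x \<le> s then - k x else k x)"
    using assms by (intro continuous_on_If continuous_intros)
      (auto intro: continuous_on_subset)
  moreover have "(\<lambda>x. if x \<le> s then - k x else k x) = (\<lambda>x. sgn (x - s) * k x)"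
    using assms by (auto simp: fun_eq_iff sgn_real_def)
  moreover have "{..s} \<union> {s..} = UNIV" by auto
  ultimately show ?thesis by metis
qed

lemma integrable_cusp: "integrable lebesgue (cusp s)"
proof -
  have "((\<lambda>x. exp (- 1 * x)) has_integral exp (- 1 * 0) / 1) {0::real..}"
    by (rule has_integral_exp_minus_to_infinity) simp
  then have "(\<lambda>x::real. exp (- x)) absolutely_integrable_on {0..}"
    by (intro nonnegative_absolutely_integrable_1) (auto simp: integrable_on_def)
  then have "integrable lebesgue (\<lambda>x::real. indicator {0..} x *\<^sub>R exp (- x))"
    by (simp add: set_integrable_def)
  then have pos: "integrable lborel (\<lambda>x::real. indicator {0..} x *\<^sub>R exp (- x))" (is "integrable _ ?f")
    by (subst (asm) integrable_completion) auto
  have right: "integrable lborel (\<lambda>x. ?f (- s + 1 * x))"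
    by (rule lborel_integrable_real_affine[OF pos]) simp
  have left: "integrable lborel (\<lambda>x. ?f (s + (- 1) * x))"
    by (rule lborel_integrable_real_affine[OF pos]) simp
  have "integrable lborel (cusp s)"
    by (rule Bochner_Integration.integrable_bound[OF Bochner_Integration.integrable_add[OF left right]])
      (auto simp: cusp_def indicator_def)
  then show ?thesis by (subst integrable_completion) auto
qed

lemma integrable_cusp_mult_bounded:
  assumes f: "f \<in> borel_measurable borel" and bnd: "\<And>x. \<bar>f x\<bar> \<le> B"
  shows "integrable lebesgue (\<lambda>x. cusp s x * f x)"
proof (rule Bochner_Integration.integrable_bound)
  show "integrable lebesgue (\<lambda>x. B * cusp s x)"
    using integrable_cusp by simp
  show "(\<lambda>x. cusp s x * f x) \<in> borel_measurable lebesgue"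
    using f by (intro measurable_completion) simp
  have "\<bar>f x\<bar> \<le> \<bar>B\<bar>" for x using bnd[of x] by linarith
  then show "AE x in lebesgue. norm (cusp s x * f x) \<le> norm (B * cusp s x)"
    by (intro always_eventually) (auto simp: abs_mult mult.commute[of "cusp s _"] intro!: mult_right_mono)
qed

lemma p_eq_cusp: "p (x - y) = cusp x y / 2"
  by (simp add: p_def cusp_def abs_minus_commute)

lemma conv_exists_p:
  assumes "f \<in> borel_measurable borel" "\<And>x. \<bar>f x\<bar> \<le> B"
  shows "conv_exists p f"
  unfolding conv_exists_def p_eq_cusp
  using integrable_cusp_mult_bounded[OF assms] by auto

text \<open>All improper integrals are evaluated through this limit: on a bounded interval the fundamental
  theorem of calculus tolerates finitely many points where the antiderivative has no derivative.\<close>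

lemma integral_symmetric_intervals_tendsto:
  fixes f :: "real \<Rightarrow> real"
  assumes f: "integrable lebesgue f"
  shows "(\<lambda>k. integral {- real k..real k} f) \<longlonglongrightarrow> integral\<^sup>L lebesgue f"
proof -
  have "(\<lambda>k. LINT x|lebesgue. indicator {- real k..real k} x *\<^sub>R f x) \<longlonglongrightarrow> integral\<^sup>L lebesgue f"
  proof (rule integral_dominated_convergence[where w="\<lambda>x. \<bar>f x\<bar>"])
    show "AE x in lebesgue. (\<lambda>k. indicator {- real k..real k} x *\<^sub>R f x) \<longlonglongrightarrow> f x"
    proof (intro always_eventually allI)
      fix x
      obtain N where "\<bar>x\<bar> \<le> real N" using real_arch_simple by blast
      then have "\<forall>k\<ge>N. indicator {- real k..real k} x *\<^sub>R f x = f x"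
        by (auto simp: indicator_def)
      then show "(\<lambda>k. indicator {- real k..real k} x *\<^sub>R f x) \<longlonglongrightarrow> f x"
        by (intro tendsto_eventually) (auto simp: eventually_sequentially)
    qed
    show "(\<lambda>x. indicator {- real k..real k} x *\<^sub>R f x) \<in> borel_measurable lebesgue" for k
      by (intro borel_measurable_integrable integrable_mult_indicator f) simp
  qed (use f in \<open>auto simp: indicator_def\<close>)
  moreover have "(LINT x|lebesgue. indicator {- real k..real k} x *\<^sub>R f x) = integral {- real k..real k} f" for k
  proof -
    have "f absolutely_integrable_on {- real k..real k}"
      unfolding set_integrable_def by (rule integrable_mult_indicator[OF _ f]) simp
    from set_lebesgue_integral_eq_integral(2)[OF this] show ?thesis
      by (simp add: set_lebesgue_integral_def)
  qed
  ultimately show ?thesis by simp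
qed

section \<open>Convolution with the Green function\<close>

text \<open>The kernel \<open>p\<close> is the bounded fundamental solution of \<open>1 - d\<^sup>2/dx\<^sup>2\<close>, so a \<open>C\<^sup>1\<close> function that is
  bounded together with its derivative is recovered from \<open>w - w''\<close>, even if \<open>w''\<close> is undefined at a
  point. In the variable \<open>y\<close> and on either side of \<open>x\<close>, where \<open>p (x - y)\<close> is half an exponential,
  \<open>p (x - y) * (w y - w'' y)\<close> has an elementary antiderivative vanishing at infinity; the jump of that
  antiderivative at \<open>y = x\<close> is \<open>- w x\<close>. Adding the constant \<open>w x\<close> on the right makes it continuous,
  and its limits at \<open>-\<infinity>\<close> and \<open>\<infinity>\<close> are then \<open>0\<close> and \<open>w x\<close>.\<close>

lemma conv_p_fundamental_solution:
  fixes w w' w'' h :: "real \<Rightarrow> real"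
  assumes cont: "continuous_on UNIV w" "continuous_on UNIV w'"
    and bnd: "\<And>y. \<bar>w y\<bar> \<le> B" "\<And>y. \<bar>w' y\<bar> \<le> B"
    and w': "\<And>y. y \<noteq> s \<Longrightarrow> (w has_real_derivative w' y) (at y)"
    and w'': "\<And>y. y \<noteq> s \<Longrightarrow> (w' has_real_derivative w'' y) (at y)"
    and h: "\<And>y. y \<noteq> s \<Longrightarrow> h y = w y - w'' y"
    and ex: "conv_exists p h"
  shows "conv p h x = w x"
proof -
  define F where "F y = (if y \<le> x then (w y - w' y) * exp (y - x) / 2
                         else w x - (w y + w' y) * exp (x - y) / 2)" for y
  have contF: "continuous_on UNIV F"
  proof -
    have "continuous_on ({..x} \<union> {x..}) F"
      unfolding F_def
      by (intro continuous_on_If continuous_intros)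
        (auto intro!: continuous_intros intro: continuous_on_subset[OF cont(1)] continuous_on_subset[OF cont(2)] simp: field_simps)
    moreover have "{..x} \<union> {x..} = UNIV" by auto
    ultimately show ?thesis by simp
  qed
  have derF: "(F has_real_derivative p (x - y) * h y) (at y)" if "y \<noteq> x" "y \<noteq> s" for y
  proof (cases "y < x")
    case True
    have "((\<lambda>y. (w y - w' y) * exp (y - x) / 2) has_real_derivative p (x - y) * h y) (at y)"
      using True that
      by (auto intro!: derivative_eq_intros w' w'' simp: h p_def field_simps)
    then show ?thesis
      by (rule has_field_derivative_transform_within_open[where S="{..<x}"]) (use True in \<open>auto simp: F_def\<close>)
  next
    case False
    then have gt: "x < y" using that by simp
    have "((\<lambda>y. w x - (w y + w' y) * exp (x - y) / 2) has_real_derivative p (x - y) * h y) (at y)"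
      using gt that
      by (auto intro!: derivative_eq_intros w' w'' simp: h p_def field_simps)
    then show ?thesis
      by (rule has_field_derivative_transform_within_open[where S="{x<..}"]) (use gt in \<open>auto simp: F_def\<close>)
  qed
  have "integral {- real k..real k} (\<lambda>y. p (x - y) * h y) = F (real k) - F (- real k)" for k
  proof (intro integral_unique fundamental_theorem_of_calculus_interior_strong[where S="{x, s}"])
    show "continuous_on {- real k..real k} F" by (rule continuous_on_subset[OF contF]) simp
  qed (use derF in \<open>auto simp: has_real_derivative_iff_has_vector_derivative\<close>)
  moreover have "(\<lambda>k. F (real k) - F (- real k)) \<longlonglongrightarrow> w x - 0"
  proof (rule tendsto_diff)
    have e: "(\<lambda>k. exp (c - real k) :: real) \<longlonglongrightarrow> 0" for c
      by real_asymp
    have z: "(\<lambda>k. g k * exp (c - real k) / 2) \<longlonglongrightarrow> 0" if "\<And>k. \<bar>g k\<bar> \<le> 2 * B" for g c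
    proof -
      have "(\<lambda>k. exp (c - real k) * g k) \<longlonglongrightarrow> 0"
        by (rule lim_null_mult_right_bounded[OF e always_eventually]) (use that in auto)
      from tendsto_divide[OF this tendsto_const[of 2]] show ?thesis by (simp add: mult.commute)
    qed
    obtain N where N: "\<bar>x\<bar> < real N" using reals_Archimedean2 by blast
    have b: "\<bar>w y - w' y\<bar> \<le> 2 * B" "\<bar>w y + w' y\<bar> \<le> 2 * B" for y
      using bnd[of y] by linarith+
    have "(\<lambda>k. w x - (w (real k) + w' (real k)) * exp (x - real k) / 2) \<longlonglongrightarrow> w x - 0"
      by (intro tendsto_diff tendsto_const z b)
    moreover have "\<forall>\<^sub>F k in sequentially. w x - (w (real k) + w' (real k)) * exp (x - real k) / 2 = F (real k)"
      unfolding eventually_sequentially by (rule exI[of _ N]) (use N in \<open>auto simp: F_def\<close>)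
    ultimately show "(\<lambda>k. F (real k)) \<longlonglongrightarrow> w x"
      using Lim_transform_eventually by fastforce
    have "(\<lambda>k. (w (- real k) - w' (- real k)) * exp (- x - real k) / 2) \<longlonglongrightarrow> 0"
      by (intro z b)
    moreover have "\<forall>\<^sub>F k in sequentially. (w (- real k) - w' (- real k)) * exp (- x - real k) / 2 = F (- real k)"
      unfolding eventually_sequentially by (rule exI[of _ N]) (use N in \<open>auto simp: F_def minus_diff_commute\<close>)
    ultimately show "(\<lambda>k. F (- real k)) \<longlonglongrightarrow> 0"
      by (rule Lim_transform_eventually)
  qed
  moreover have "(\<lambda>k. integral {- real k..real k} (\<lambda>y. p (x - y) * h y)) \<longlonglongrightarrow> conv p h x"
    unfolding conv_def using ex by (intro integral_symmetric_intervals_tendsto) (simp add: conv_exists_def)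
  ultimately show ?thesis
    using LIMSEQ_unique by fastforce
qed

lemma abs_mult_divide_le:
  fixes A k d :: real
  assumes "0 < d" "\<bar>k\<bar> \<le> d"
  shows "\<bar>A * k / d\<bar> \<le> \<bar>A\<bar>"
  using mult_left_mono[OF assms(2), of "\<bar>A\<bar>"] assms(1) by (simp add: abs_mult divide_le_eq)

text \<open>The potential of \<open>cusp s y ^ n\<close> is \<open>(n * cusp s x - cusp s x ^ n) / (n\<^sup>2 - 1)\<close>: away from the crest
  \<open>(1 - d\<^sup>2/dx\<^sup>2)\<close> multiplies the \<open>n\<close>-th power by \<open>1 - n\<^sup>2\<close> and annihilates the first power, whose
  coefficient is chosen so that the one-sided slopes at the crest cancel.\<close>

lemma conv_p_even:
  assumes h: "\<And>y. y \<noteq> s \<Longrightarrow> h y = A * cusp s y ^ 3 + B * cusp s y ^ 2" and ex: "conv_exists p h"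
  shows "conv p h x = A * (3 * cusp s x - cusp s x ^ 3) / 8 + B * (2 * cusp s x - cusp s x ^ 2) / 3"
proof -
  define w' where "w' y = sgn (y - s) *
    (A * (3 * cusp s y ^ 3 - 3 * cusp s y) / 8 + B * (2 * cusp s y ^ 2 - 2 * cusp s y) / 3)" for y
  define w'' where "w'' y = 
    3 * A * (cusp s y - 3 * cusp s y ^ 3) / 8 + 2 * B * (cusp s y - 2 * cusp s y ^ 2) / 3" for y
  have p01: "0 \<le> cusp s y ^ n" "cusp s y ^ n \<le> 1" for y n
    by (simp_all add: power_le_one)
  show ?thesis
  proof (rule conv_p_fundamental_solution[where w'=w' and w''=w'' and s=s and B="\<bar>A\<bar> + \<bar>B\<bar>"])
    show "continuous_on UNIV (\<lambda>x. A * (3 * cusp s x - cusp s x ^ 3) / 8 + B * (2 * cusp s x - cusp s x ^ 2) / 3)"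
      by (intro continuous_intros) auto
    show "continuous_on UNIV w'"
      unfolding w'_def by (intro continuous_on_sgn_mult continuous_intros) (auto simp: cusp_def)
    fix y
    have "\<bar>A * (3 * cusp s y - cusp s y ^ 3) / 8\<bar> \<le> \<bar>A\<bar>"
      by (rule abs_mult_divide_le) (use cusp_ge_0[of s y] cusp_le_1[of s y] p01[of y 3] in linarith)+
    moreover have "\<bar>B * (2 * cusp s y - cusp s y ^ 2) / 3\<bar> \<le> \<bar>B\<bar>"
      by (rule abs_mult_divide_le) (use cusp_ge_0[of s y] cusp_le_1[of s y] p01[of y 2] in linarith)+
    ultimately show "\<bar>A * (3 * cusp s y - cusp s y ^ 3) / 8 + B * (2 * cusp s y - cusp s y ^ 2) / 3\<bar> \<le> \<bar>A\<bar> + \<bar>B\<bar>"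
      by simp
    have "\<bar>A * (3 * cusp s y ^ 3 - 3 * cusp s y) / 8\<bar> \<le> \<bar>A\<bar>"
      by (rule abs_mult_divide_le) (use cusp_ge_0[of s y] cusp_le_1[of s y] p01[of y 3] in linarith)+
    moreover have "\<bar>B * (2 * cusp s y ^ 2 - 2 * cusp s y) / 3\<bar> \<le> \<bar>B\<bar>"
      by (rule abs_mult_divide_le) (use cusp_ge_0[of s y] cusp_le_1[of s y] p01[of y 2] in linarith)+
    ultimately have "\<bar>A * (3 * cusp s y ^ 3 - 3 * cusp s y) / 8 + B * (2 * cusp s y ^ 2 - 2 * cusp s y) / 3\<bar> \<le> \<bar>A\<bar> + \<bar>B\<bar>"
      by linarith
    then show "\<bar>w' y\<bar> \<le> \<bar>A\<bar> + \<bar>B\<bar>"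
      unfolding w'_def abs_mult by (auto simp: sgn_real_def)
  next
    fix y assume y: "y \<noteq> s"
    then have s2: "sgn (y - s) * sgn (y - s) = 1" by (auto simp: sgn_real_def)
    show "((\<lambda>x. A * (3 * cusp s x - cusp s x ^ 3) / 8 + B * (2 * cusp s x - cusp s x ^ 2) / 3)
            has_real_derivative w' y) (at y)"
      using y by (auto intro!: derivative_eq_intros cusp_deriv simp: w'_def field_simps power3_eq_cube power2_eq_square)
    show "(w' has_real_derivative w'' y) (at y)"
      unfolding w'_def[abs_def] using y s2
      by (auto intro!: derivative_eq_intros cusp_deriv sgn_deriv simp: w''_def) (cases "s < y"; simp add: sgn_real_def field_simps power3_eq_cube power2_eq_square)
    show "h y = A * (3 * cusp s y - cusp s y ^ 3) / 8 + B * (2 * cusp s y - cusp s y ^ 2) / 3 - w'' y"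
      using h[OF y] by (simp add: w''_def field_simps)
  qed (rule ex)
qed

text \<open>As in the even case, except that the first power now has to restore continuity at the crest, where
  the sign jumps, instead of cancelling the slopes.\<close>

lemma conv_p_odd:
  assumes h: "\<And>y. y \<noteq> s \<Longrightarrow> h y = A * sgn (y - s) * cusp s y ^ 3" and ex: "conv_exists p h"
  shows "conv p h x = A * sgn (x - s) * (cusp s x - cusp s x ^ 3) / 8"
proof -
  define w where "w y = sgn (y - s) * (A * (cusp s y - cusp s y ^ 3) / 8)" for y
  define w' where "w' y = A * (3 * cusp s y ^ 3 - cusp s y) / 8" for y
  define w'' where "w'' y = sgn (y - s) * (A * (cusp s y - 9 * cusp s y ^ 3) / 8)" for y
  have p01: "0 \<le> cusp s y ^ n" "cusp s y ^ n \<le> 1" for y n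
    by (simp_all add: power_le_one)
  have "conv p h x = w x"
  proof (rule conv_p_fundamental_solution[where w'=w' and w''=w'' and s=s and B="\<bar>A\<bar>"])
    show "continuous_on UNIV w"
      unfolding w_def by (intro continuous_on_sgn_mult continuous_intros) (auto simp: cusp_def)
    show "continuous_on UNIV w'"
      unfolding w'_def by (intro continuous_intros) auto
    fix y
    have "\<bar>A * (cusp s y - cusp s y ^ 3) / 8\<bar> \<le> \<bar>A\<bar>"
      by (rule abs_mult_divide_le) (use cusp_ge_0[of s y] cusp_le_1[of s y] p01[of y 3] in linarith)+
    then show "\<bar>w y\<bar> \<le> \<bar>A\<bar>"
      by (auto simp: w_def sgn_real_def abs_mult)
    have "\<bar>A * (3 * cusp s y ^ 3 - cusp s y) / 8\<bar> \<le> \<bar>A\<bar>"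
      by (rule abs_mult_divide_le) (use cusp_ge_0[of s y] cusp_le_1[of s y] p01[of y 3] in linarith)+
    then show "\<bar>w' y\<bar> \<le> \<bar>A\<bar>" by (simp add: w'_def)
  next
    fix y assume y: "y \<noteq> s"
    then have s2: "sgn (y - s) * sgn (y - s) = 1" by (auto simp: sgn_real_def)
    show "(w has_real_derivative w' y) (at y)"
      unfolding w_def[abs_def] using y s2
      by (auto intro!: derivative_eq_intros cusp_deriv sgn_deriv simp: w'_def) (cases "s < y"; simp add: sgn_real_def field_simps power3_eq_cube power2_eq_square)
    show "(w' has_real_derivative w'' y) (at y)"
      unfolding w'_def[abs_def] using y
      by (auto intro!: derivative_eq_intros cusp_deriv simp: w''_def field_simps power3_eq_cube power2_eq_square)
    show "h y = w y - w'' y"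
      using h[OF y] by (simp add: w_def w''_def field_simps)
  qed (rule ex)
  then show ?thesis by (simp add: w_def field_simps)
qed

section \<open>Smooth functions and their supports\<close>

lemma smooth_differentiable:
  assumes "\<forall>k. Ck k \<phi>"
  shows "\<phi> differentiable (at x)"
    and "continuous_on UNIV \<phi>"
    and "continuous_on UNIV (\<lambda>x. frechet_derivative \<phi> (at x) v)"
proof -
  have "Ck 0 \<phi>" "Ck (Suc 0) \<phi>" using assms by blast+
  then show "\<phi> differentiable (at x)" "continuous_on UNIV \<phi>"
    "continuous_on UNIV (\<lambda>x. frechet_derivative \<phi> (at x) v)" by auto
qed

lemma frechet_derivative_along_curve:
  fixes \<phi> :: "'a::real_normed_vector \<Rightarrow> real"
  assumes "\<phi> differentiable (at (g t))" and "(g has_vector_derivative v) (at t)"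
  shows "((\<lambda>s. \<phi> (g s)) has_real_derivative frechet_derivative \<phi> (at (g t)) v) (at t)"
proof -
  have D: "(\<phi> has_derivative frechet_derivative \<phi> (at (g t))) (at (g t))"
    using assms(1) by (simp add: frechet_derivative_works)
  have "((\<lambda>s. \<phi> (g s)) has_derivative (\<lambda>h. frechet_derivative \<phi> (at (g t)) (h *\<^sub>R v))) (at t)"
    using assms(2) D unfolding has_vector_derivative_def by (rule has_derivative_compose)
  moreover have "(\<lambda>h. frechet_derivative \<phi> (at (g t)) (h *\<^sub>R v)) = (*) (frechet_derivative \<phi> (at (g t)) v)"
    using linear_frechet_derivative[OF assms(1)] by (auto simp: linear_scale fun_eq_iff)
  ultimately show ?thesis by (simp add: has_field_derivative_def)
qed

text \<open>This is meant for \<open>S = [0,T) \<times> \<real>\<close>, where a test function is only known to vanish off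
  its support inside that set. By continuity, the function and its derivatives also vanish on the boundary lines \<open>t = 0\<close> and \<open>t = T\<close>
  away from the support, where the two-sided derivative in time sees values outside the domain.\<close>

lemma vanishes_off_support:
  fixes \<phi> :: "'a::real_normed_vector \<Rightarrow> real"
  assumes \<phi>: "\<forall>k. Ck k \<phi>" and K: "closed K" "\<forall>z\<in>S - K. \<phi> z = 0"
    and z: "z \<in> closure (interior S)" "z \<notin> K"
  shows "\<phi> z = 0" and "frechet_derivative \<phi> (at z) v = 0"
proof -
  define U where "U = - K \<inter> interior S"
  have U: "open U" using K(1) by (auto simp: U_def)
  have zU: "z \<in> closure U"
    using open_Int_closure_subset[of "- K" "interior S"] K(1) z by (auto simp: U_def)
  have 0: "\<phi> y = 0" if "y \<in> U" for y
    using that K(2) interior_subset by (auto simp: U_def)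
  have D0: "frechet_derivative \<phi> (at y) v = 0" if "y \<in> U" for y
    using frechet_derivative_transform_within_open[OF smooth_differentiable(1)[OF \<phi>] U that, of "\<lambda>_. 0"] 0
    by simp
  show "\<phi> z = 0"
    by (rule continuous_constant_on_closure[OF _ _ zU])
      (use 0 smooth_differentiable(2)[OF \<phi>] in \<open>auto intro: continuous_on_subset\<close>)
  show "frechet_derivative \<phi> (at z) v = 0"
    by (rule continuous_constant_on_closure[OF _ _ zU])
      (use D0 smooth_differentiable(3)[OF \<phi>] in \<open>auto intro: continuous_on_subset\<close>)
qed

lemma compact_bounds_second_coordinate:
  fixes K :: "(real \<times> real) set"
  assumes "compact K"
  obtains R where "\<And>t x. (t, x) \<in> K \<Longrightarrow> \<bar>x\<bar> \<le> R"
proof -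
  obtain R where "\<And>z. z \<in> K \<Longrightarrow> norm z \<le> R"
    using compact_imp_bounded[OF assms] by (auto simp: bounded_iff)
  moreover have "\<bar>x\<bar> \<le> norm (t, x)" for t x :: real
    using norm_snd_le[of x t] by simp
  ultimately show ?thesis using that order_trans by metis
qed

lemma integrable_bounded_mult_compact_support:
  fixes g h :: "'a::euclidean_space \<Rightarrow> real"
  assumes g: "g \<in> borel_measurable borel" "\<And>x. \<bar>g x\<bar> \<le> B"
    and h: "continuous_on UNIV h"
    and K: "compact K" "K \<subseteq> S" "\<And>x. x \<in> S - K \<Longrightarrow> h x = 0"
    and S: "S \<in> sets borel"
  shows "integrable (lebesgue_on S) (\<lambda>x. g x * h x)"
proof -
  have S': "S \<in> sets lebesgue" using S by auto
  obtain C where C: "\<And>x. x \<in> K \<Longrightarrow> norm (h x) \<le> C"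
    using compact_imp_bounded[OF compact_continuous_image[OF continuous_on_subset[OF h subset_UNIV] K(1)]]
    by (auto simp: bounded_iff)
  show ?thesis
  proof (rule integrableI_bounded_set[where A=K and B="B * C"])
    show "K \<in> sets (lebesgue_on S)"
      using K compact_imp_closed[OF K(1)] S' by (auto simp: sets_restrict_space_iff)
    show "(\<lambda>x. g x * h x) \<in> borel_measurable (lebesgue_on S)"
      by (intro measurable_restrict_space1 measurable_completion)
        (use g(1) borel_measurable_continuous_onI[OF h] in simp)
    have "emeasure (lebesgue_on S) K = emeasure lborel K"
      using K S' compact_imp_closed[OF K(1)] by (subst emeasure_restrict_space) auto
    then show "emeasure (lebesgue_on S) K < \<infinity>"
      using emeasure_bounded_finite[OF compact_imp_bounded[OF K(1)]] by simp
    show "AE x in lebesgue_on S. x \<in> K \<longrightarrow> norm (g x * h x) \<le> B * C"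
    proof (intro AE_I2 impI)
      fix x assume "x \<in> K"
      have "0 \<le> B" using g(2)[of x] by linarith
      then show "norm (g x * h x) \<le> B * C"
        using g(2)[of x] C[OF \<open>x \<in> K\<close>] by (auto simp: abs_mult intro!: mult_mono)
    qed
    show "AE x in lebesgue_on S. x \<notin> K \<longrightarrow> g x * h x = 0"
      using K(3) by (intro AE_I2) auto
  qed
qed

lemma integrable_bounded_mult_bounded_support:
  fixes g h :: "real \<Rightarrow> real"
  assumes "g \<in> borel_measurable borel" "\<And>x. \<bar>g x\<bar> \<le> B"
    and "continuous_on UNIV h" "\<And>x. R < \<bar>x\<bar> \<Longrightarrow> h x = 0"
  shows "integrable lebesgue (\<lambda>x. g x * h x)"
  using integrable_bounded_mult_compact_support[of g B h "{-R..R}" UNIV] assms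
  by (simp add: lebesgue_on_UNIV_eq abs_le_iff not_le) (meson abs_le_iff linorder_not_le minus_le_iff)

section \<open>Integration by parts and translation\<close>

lemma integration_by_parts_kink:
  fixes f f' \<phi> \<phi>' :: "real \<Rightarrow> real"
  assumes f: "continuous_on UNIV f" "\<And>x. x \<noteq> s \<Longrightarrow> (f has_real_derivative f' x) (at x)"
    and \<phi>: "\<And>x. (\<phi> has_real_derivative \<phi>' x) (at x)" "\<And>x. R < \<bar>x\<bar> \<Longrightarrow> \<phi> x = 0"
    and int: "integrable lebesgue (\<lambda>x. f x * \<phi>' x + f' x * \<phi> x)"
  shows "(LINT x|lebesgue. f x * \<phi>' x + f' x * \<phi> x) = 0"
proof -
  have "continuous_on UNIV \<phi>"
    using \<phi>(1) DERIV_isCont continuous_at_imp_continuous_on by blast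
  then have cont: "continuous_on A (\<lambda>x. f x * \<phi> x)" for A
    using f(1) by (intro continuous_intros) (auto intro: continuous_on_subset)
  have "integral {- real k..real k} (\<lambda>x. f x * \<phi>' x + f' x * \<phi> x)
        = f (real k) * \<phi> (real k) - f (- real k) * \<phi> (- real k)" for k
  proof (intro integral_unique fundamental_theorem_of_calculus_interior_strong[where S="{s}"])
    fix x assume "x \<in> {- real k<..<real k} - {s}"
    then show "((\<lambda>x. f x * \<phi> x) has_vector_derivative f x * \<phi>' x + f' x * \<phi> x) (at x)"
      unfolding has_real_derivative_iff_has_vector_derivative[symmetric]
      by (auto intro!: derivative_eq_intros f(2) \<phi>(1))
  qed (use cont in auto)
  moreover obtain N where N: "R < real N" using reals_Archimedean2 by blast
  then have "\<forall>\<^sub>F k in sequentially. f (real k) * \<phi> (real k) - f (- real k) * \<phi> (- real k) = 0"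
    unfolding eventually_sequentially by (intro exI[of _ N]) (auto simp: \<phi>(2))
  ultimately have "(\<lambda>k. integral {- real k..real k} (\<lambda>x. f x * \<phi>' x + f' x * \<phi> x)) \<longlonglongrightarrow> 0"
    by (simp add: tendsto_eventually)
  then show ?thesis
    using integral_symmetric_intervals_tendsto[OF int] LIMSEQ_unique by blast
qed

text \<open>Moving to the frame of the crest and cutting off at a fixed interval turns a Lebesgue integral over
  the line into an integral over a compact interval, to which differentiation under the integral
  sign applies.\<close>

lemma lebesgue_integral_shifted_interval:
  fixes f :: "real \<Rightarrow> real"
  assumes f: "continuous_on UNIV f" "\<And>x. R < \<bar>x\<bar> \<Longrightarrow> f x = 0" and R': "R + \<bar>s\<bar> \<le> R'"
  shows "integral\<^sup>L lebesgue f = integral {-R'..R'} (\<lambda>y. f (y + s))"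
proof -
  have "integrable lebesgue f"
    using integrable_bounded_mult_bounded_support[of "\<lambda>_. 1" 1 f R] f by simp
  then have "(f has_integral integral\<^sup>L lebesgue f) UNIV"
    by (rule has_integral_integral_lebesgue)
  moreover have "f = (\<lambda>x. if x \<in> {-R' + s..R' + s} then f x else 0)"
    using f(2) R' by (force simp: fun_eq_iff)
  ultimately have "(f has_integral integral\<^sup>L lebesgue f) {-R' + s..R' + s}"
    by (metis has_integral_restrict_UNIV)
  from has_integral_shift_real_ivl[OF this, of s] show ?thesis
    by (simp add: integral_unique)
qed

section \<open>The peakon in the function spaces\<close>

text \<open>The pointwise derivative of the peakon off its crest. Its value on the crest is \<open>0\<close> because
  \<open>sgn 0 = 0\<close>.\<close>

definition peakon_x :: "real \<Rightarrow> real \<Rightarrow> real \<Rightarrow> real \<Rightarrow> real \<Rightarrow> real" where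
  "peakon_x a c x0 t x = - a * sgn (x - (c * t + x0)) * cusp (c * t + x0) x"

lemma peakon_eq_cusp: "peakon a c x0 t x = a * cusp (c * t + x0) x"
  by (simp add: peakon_def cusp_def algebra_simps)

lemma L3_on_cusp_mult_bounded:
  assumes g: "g \<in> borel_measurable borel" "\<And>x. \<bar>g x\<bar> \<le> B" and S: "S \<in> sets lebesgue"
  shows "L3_on S (\<lambda>x. g x * cusp s x)"
  unfolding L3_on_def
proof
  show "(\<lambda>x. g x * cusp s x) \<in> borel_measurable (lebesgue_on S)"
    by (intro measurable_restrict_space1 measurable_completion) (use g(1) in simp)
  have "integrable lebesgue (\<lambda>x. cusp s x * (cusp s x ^ 2 * \<bar>g x\<bar> ^ 3))"
  proof (rule integrable_cusp_mult_bounded)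
    show "(\<lambda>x. cusp s x ^ 2 * \<bar>g x\<bar> ^ 3) \<in> borel_measurable borel" using g(1) by simp
    have "cusp s x ^ 2 * \<bar>g x\<bar> ^ 3 \<le> 1 * B ^ 3" for x
      by (intro mult_mono power_mono power_le_one g) auto
    then show "\<bar>cusp s x ^ 2 * \<bar>g x\<bar> ^ 3\<bar> \<le> B ^ 3" for x by (simp add: abs_mult)
  qed
  moreover have "cusp s x * (cusp s x ^ 2 * \<bar>g x\<bar> ^ 3) = \<bar>g x * cusp s x\<bar> ^ 3" for x
  proof -
    have "\<bar>g x * cusp s x\<bar> = \<bar>g x\<bar> * cusp s x" by (simp add: abs_mult)
    then show ?thesis by algebra
  qed
  ultimately have "integrable lebesgue (\<lambda>x. \<bar>g x * cusp s x\<bar> ^ 3)"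
    by simp
  then have "integrable lebesgue (\<lambda>x. indicator S x *\<^sub>R \<bar>g x * cusp s x\<bar> ^ 3)"
    by (rule integrable_mult_indicator[OF S])
  then show "integrable (lebesgue_on S) (\<lambda>x. \<bar>g x * cusp s x\<bar> ^ 3)"
    using S by (subst integrable_restrict_space) auto
qed

lemma weak_deriv_peakon: "weak_deriv (peakon a c x0 t) (peakon_x a c x0 t)"
proof -
  define s where "s = c * t + x0"
  have u: "peakon a c x0 t = (\<lambda>x. a * cusp s x)"
    by (simp add: peakon_eq_cusp s_def fun_eq_iff)
  have ux: "peakon_x a c x0 t = (\<lambda>x. - a * sgn (x - s) * cusp s x)"
    by (simp add: peakon_x_def s_def fun_eq_iff)
  have bnd: "\<bar>a * cusp s x\<bar> \<le> \<bar>a\<bar>" "\<bar>- a * sgn (x - s) * cusp s x\<bar> \<le> \<bar>a\<bar>" for x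
    by (auto simp: abs_mult sgn_real_def intro!: mult_left_le)
  have meas: "(\<lambda>x. a * cusp s x) \<in> borel_measurable borel"
    "(\<lambda>x. - a * sgn (x - s) * cusp s x) \<in> borel_measurable borel" by measurable
  have "integrable lebesgue (\<lambda>x. cusp s x * a)"
    by (rule integrable_cusp_mult_bounded[where B="\<bar>a\<bar>"]) auto
  moreover have "integrable lebesgue (\<lambda>x. cusp s x * (- a * sgn (x - s)))"
    by (rule integrable_cusp_mult_bounded[where B="\<bar>a\<bar>"])
      (auto simp: abs_mult sgn_real_def)
  ultimately have int: "integrable lebesgue (\<lambda>x. a * cusp s x)"
    "integrable lebesgue (\<lambda>x. - a * sgn (x - s) * cusp s x)"
    by (simp_all add: mult_ac)
  have "(LINT x|lebesgue. a * cusp s x * deriv \<phi> x) = - (LINT x|lebesgue. - a * sgn (x - s) * cusp s x * \<phi> x)"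
    if \<phi>: "\<phi> \<in> Cc_infinity UNIV" for \<phi>
  proof -
    from \<phi> obtain K where sm: "\<forall>k. Ck k \<phi>" and K: "compact K" "\<forall>z\<in>UNIV - K. \<phi> z = 0"
      by (auto simp: Cc_infinity_def)
    obtain R where R: "\<And>x. x \<in> K \<Longrightarrow> \<bar>x\<bar> \<le> R"
      using compact_imp_bounded[OF K(1)] by (auto simp: bounded_iff)
    have D: "(\<phi> has_real_derivative frechet_derivative \<phi> (at x) 1) (at x)" for x
      using frechet_derivative_along_curve[OF smooth_differentiable(1)[OF sm] has_vector_derivative_id] by simp
    then have d: "deriv \<phi> x = frechet_derivative \<phi> (at x) 1" for x
      by (rule DERIV_imp_deriv)
    note 0 = vanishes_off_support[OF sm compact_imp_closed[OF K(1)] K(2)]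
    have i1: "integrable lebesgue (\<lambda>x. a * cusp s x * deriv \<phi> x)"
      unfolding d by (rule integrable_bounded_mult_bounded_support[OF meas(1) bnd(1) smooth_differentiable(3)[OF sm], of R])
        (use 0(2) R in force)
    have i2: "integrable lebesgue (\<lambda>x. - a * sgn (x - s) * cusp s x * \<phi> x)"
      by (rule integrable_bounded_mult_bounded_support[OF meas(2) bnd(2) smooth_differentiable(2)[OF sm], of R])
        (use 0(1) R in force)
    have "(LINT x|lebesgue. a * cusp s x * deriv \<phi> x + - a * sgn (x - s) * cusp s x * \<phi> x) = 0"
    proof (rule integration_by_parts_kink[where s=s and R=R])
      show "continuous_on UNIV (\<lambda>x. a * cusp s x)" by (intro continuous_intros)
      show "((\<lambda>x. a * cusp s x) has_real_derivative - a * sgn (x - s) * cusp s x) (at x)" if "x \<noteq> s" for x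
        using that by (auto intro!: derivative_eq_intros cusp_deriv)
      show "(\<phi> has_real_derivative deriv \<phi> x) (at x)" for x using D d by simp
      show "\<phi> x = 0" if "R < \<bar>x\<bar>" for x using that K(2) R by force
    qed (intro Bochner_Integration.integrable_add i1 i2)
    then show ?thesis
      using Bochner_Integration.integral_add[OF i1 i2] by linarith
  qed
  moreover have "f absolutely_integrable_on K" if "integrable lebesgue f" "compact K" for f :: "real \<Rightarrow> real" and K
    unfolding set_integrable_def
    by (rule integrable_mult_indicator[OF _ that(1)]) (use compact_imp_closed[OF that(2)] in auto)
  ultimately show ?thesis
    unfolding weak_deriv_def u ux using int by blast
qed

lemma W13_peakon: "W13 (peakon a c x0 t)"
proof -
  have "L3_on UNIV (peakon a c x0 t)"
    using L3_on_cusp_mult_bounded[of "\<lambda>_. a" "\<bar>a\<bar>" UNIV "c * t + x0"]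
    by (simp add: peakon_eq_cusp[abs_def])
  moreover have "L3_on UNIV (peakon_x a c x0 t)"
    unfolding peakon_x_def[abs_def]
    by (rule L3_on_cusp_mult_bounded[where B="\<bar>a\<bar>"]) (auto simp: abs_mult sgn_real_def)
  ultimately show ?thesis
    unfolding W13_def using weak_deriv_peakon by blast
qed

lemma abs_peakon_le: "\<bar>peakon a c x0 t x\<bar> \<le> \<bar>a\<bar>" "\<bar>peakon_x a c x0 t x\<bar> \<le> \<bar>a\<bar>"
  by (auto simp: peakon_eq_cusp peakon_x_def abs_mult sgn_real_def intro!: mult_left_le)

lemma borel_measurable_peakon:
  "(\<lambda>(t, x). peakon a c x0 t x) \<in> borel_measurable borel"
  "(\<lambda>(t, x). peakon_x a c x0 t x) \<in> borel_measurable borel"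
  unfolding peakon_eq_cusp peakon_x_def cusp_def borel_prod[symmetric] by measurable

lemma Linf_loc_W13_loc_peakon: "Linf_loc_W13_loc T (peakon a c x0) (peakon_x a c x0)"
  unfolding Linf_loc_W13_loc_def
proof (intro conjI allI impI)
  show "(\<lambda>(t, x). peakon a c x0 t x) \<in> borel_measurable (lebesgue_on ({0..<T} \<times> UNIV))"
    "(\<lambda>(t, x). peakon_x a c x0 t x) \<in> borel_measurable (lebesgue_on ({0..<T} \<times> UNIV))"
    using borel_measurable_peakon by (intro measurable_restrict_space1 measurable_completion; simp)+
  show "AE t in lebesgue_on {0..<T}. weak_deriv (peakon a c x0 t) (peakon_x a c x0 t)"
    by (intro AE_I2 weak_deriv_peakon)
next
  fix T' :: real and K :: "real set"
  assume *: "0 \<le> T' \<and> T' < T \<and> compact K"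
  then have K: "K \<in> sets lebesgue" "K \<in> lmeasurable"
    using compact_imp_closed lmeasurable_compact by auto
  have L3: "L3_on K (peakon a c x0 t)" "L3_on K (peakon_x a c x0 t)" for t
  proof -
    show "L3_on K (peakon a c x0 t)"
      using L3_on_cusp_mult_bounded[of "\<lambda>_. a" "\<bar>a\<bar>" K "c * t + x0"] K
      by (simp add: peakon_eq_cusp[abs_def])
    show "L3_on K (peakon_x a c x0 t)"
      unfolding peakon_x_def[abs_def]
      by (rule L3_on_cusp_mult_bounded[where B="\<bar>a\<bar>"]) (use K in \<open>auto simp: abs_mult sgn_real_def\<close>)
  qed
  show "\<exists>M. AE t in lebesgue_on {0..T'}. L3_on K (peakon a c x0 t) \<and> L3_on K (peakon_x a c x0 t) \<and>
           (LINT x|lebesgue_on K. \<bar>peakon a c x0 t x\<bar> ^ 3 + \<bar>peakon_x a c x0 t x\<bar> ^ 3) \<le> M"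
  proof (intro exI AE_I2 conjI L3)
    fix t
    interpret finite_measure "lebesgue_on K" by (rule finite_measure_lebesgue_on[OF K(2)])
    show "(LINT x|lebesgue_on K. \<bar>peakon a c x0 t x\<bar> ^ 3 + \<bar>peakon_x a c x0 t x\<bar> ^ 3)
          \<le> (LINT x|lebesgue_on K. \<bar>a\<bar> ^ 3 + \<bar>a\<bar> ^ 3)"
    proof (rule integral_mono)
      show "integrable (lebesgue_on K) (\<lambda>x. \<bar>peakon a c x0 t x\<bar> ^ 3 + \<bar>peakon_x a c x0 t x\<bar> ^ 3)"
        using L3[of t] by (auto simp: L3_on_def)
      show "\<bar>peakon a c x0 t x\<bar> ^ 3 + \<bar>peakon_x a c x0 t x\<bar> ^ 3 \<le> \<bar>a\<bar> ^ 3 + \<bar>a\<bar> ^ 3" for x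
        by (intro add_mono power_mono abs_peakon_le) auto
    qed simp
  qed
qed

section \<open>The nonlinear terms collapse to a transport term\<close>

text \<open>Off the crest the square of \<open>u\<^sub>x\<close> equals that of \<open>u\<close>, so all terms are powers of the profile.\<close>

lemma source1_peakon:
  assumes "x \<noteq> c * t + x0"
  shows "source1 k1 k2 k3 (peakon a c x0 t x) (peakon_x a c x0 t x)
    = (5 * k1 / 3 + 5 * k2 / 2) * a ^ 3 * cusp (c * t + x0) x ^ 3 + 3 * k3 / 2 * a\<^sup>2 * cusp (c * t + x0) x ^ 2"
  using assms by (cases "x < c * t + x0";
    simp add: source1_def peakon_eq_cusp peakon_x_def sgn_real_def field_simps power3_eq_cube power2_eq_square)

lemma source0_peakon:
  "source0 k1 k2 (peakon_x a c x0 t x)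
    = - (k1 / 3 + k2 / 2) * a ^ 3 * sgn (x - (c * t + x0)) * cusp (c * t + x0) x ^ 3"
  by (cases "x < c * t + x0"; cases "x = c * t + x0";
    simp add: source0_def peakon_x_def sgn_real_def field_simps power3_eq_cube)

lemma conv_exists_source:
  "conv_exists p (\<lambda>y. source0 k1 k2 (peakon_x a c x0 t y))"
  "conv_exists p (\<lambda>y. source1 k1 k2 k3 (peakon a c x0 t y) (peakon_x a c x0 t y))"
proof -
  have m: "peakon a c x0 t \<in> borel_measurable borel" "peakon_x a c x0 t \<in> borel_measurable borel"
    unfolding peakon_eq_cusp[abs_def] peakon_x_def[abs_def] by measurable
  have le: "\<bar>peakon a c x0 t y\<bar> ^ n \<le> \<bar>a\<bar> ^ n" "\<bar>peakon_x a c x0 t y\<bar> ^ n \<le> \<bar>a\<bar> ^ n" for y n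
    by (intro power_mono abs_peakon_le; simp)+
  show "conv_exists p (\<lambda>y. source0 k1 k2 (peakon_x a c x0 t y))"
  proof (rule conv_exists_p)
    show "(\<lambda>y. source0 k1 k2 (peakon_x a c x0 t y)) \<in> borel_measurable borel"
      unfolding source0_def using m by measurable
    show "\<bar>source0 k1 k2 (peakon_x a c x0 t y)\<bar> \<le> \<bar>k1 / 3 + k2 / 2\<bar> * \<bar>a\<bar> ^ 3" for y
      unfolding source0_def abs_mult power_abs by (intro mult_left_mono le[unfolded power_abs]) simp
  qed
  show "conv_exists p (\<lambda>y. source1 k1 k2 k3 (peakon a c x0 t y) (peakon_x a c x0 t y))"
  proof (rule conv_exists_p)
    show "(\<lambda>y. source1 k1 k2 k3 (peakon a c x0 t y) (peakon_x a c x0 t y)) \<in> borel_measurable borel"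
      unfolding source1_def using m by measurable
    fix y
    let ?u = "peakon a c x0 t y" and ?v = "peakon_x a c x0 t y"
    have "\<bar>(2 * k1 / 3 + k2) * ?u ^ 3\<bar> \<le> \<bar>2 * k1 / 3 + k2\<bar> * \<bar>a\<bar> ^ 3"
      "\<bar>(k1 + 3 * k2 / 2) * ?u * ?v\<^sup>2\<bar> \<le> \<bar>k1 + 3 * k2 / 2\<bar> * \<bar>a\<bar> * \<bar>a\<bar>\<^sup>2"
      "\<bar>k3 * ?u\<^sup>2\<bar> \<le> \<bar>k3\<bar> * \<bar>a\<bar>\<^sup>2"
      "\<bar>k3 / 2 * ?v\<^sup>2\<bar> \<le> \<bar>k3 / 2\<bar> * \<bar>a\<bar>\<^sup>2"
      unfolding abs_mult power_abs by (intro mult_mono abs_peakon_le le; simp)+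
    then show "\<bar>source1 k1 k2 k3 ?u ?v\<bar>
      \<le> \<bar>2 * k1 / 3 + k2\<bar> * \<bar>a\<bar> ^ 3 + \<bar>k1 + 3 * k2 / 2\<bar> * \<bar>a\<bar> * \<bar>a\<bar>\<^sup>2
        + \<bar>k3\<bar> * \<bar>a\<bar>\<^sup>2 + \<bar>k3 / 2\<bar> * \<bar>a\<bar>\<^sup>2"
      unfolding source1_def by (intro order_trans[OF abs_triangle_ineq] add_mono)
  qed
qed

text \<open>The algebraic core, and the place where the speed \<open>c\<close> is determined. Off the crest, the bracket in
  the conclusion is the \<open>x\<close>-derivative of \<open>(\<alpha> * cusp s x ^ 3 + \<beta> * cusp s x) * \<phi>\<close>, so only transport of
  the profile with speed \<open>c\<close> contributes to the integral. After inserting the convolutions, the cubic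
  terms in the coefficients of \<open>\<phi>\<close> and \<open>\<phi>\<^sub>x\<close> fit together for every choice of the \<open>k\<^sub>i\<close>. The linear ones
  fit together after \<open>a * c * cusp s x * \<phi>\<^sub>x\<close> is split off, and this is what fixes \<open>c\<close>.\<close>

lemma weak_integrand_peakon:
  fixes k1 k2 k3 a c x0 t :: real
  defines "s \<equiv> c * t + x0"
    and "\<alpha> \<equiv> (k1 / 8 + k2 / 48) * a ^ 3"
    and "\<beta> \<equiv> - (k1 / 3 + k2 / 2) * a ^ 3 / 8"
  assumes c: "c = (2 * k1 / 3 + k2) * a\<^sup>2 + k3 * a"
    and dt: "((\<lambda>r. \<phi> (r, x)) has_real_derivative \<phi>t) (at t)"
    and dx: "((\<lambda>y. \<phi> (t, y)) has_real_derivative \<phi>x) (at x)"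
  shows "weak_integrand k1 k2 k3 (peakon a c x0) (peakon_x a c x0) \<phi> t x
    = a * cusp s x * (\<phi>t + c * \<phi>x)
      + ((\<alpha> * cusp s x ^ 3 + \<beta> * cusp s x) * \<phi>x
         + - sgn (x - s) * (3 * \<alpha> * cusp s x ^ 3 + \<beta> * cusp s x) * \<phi> (t, x))"
proof -
  have c0: "conv p (\<lambda>y. source0 k1 k2 (peakon_x a c x0 t y)) x
    = - (k1 / 3 + k2 / 2) * a ^ 3 * sgn (x - s) * (cusp s x - cusp s x ^ 3) / 8"
    by (intro conv_p_odd conv_exists_source) (simp only: source0_peakon s_def)
  have c1: "conv p (\<lambda>y. source1 k1 k2 k3 (peakon a c x0 t y) (peakon_x a c x0 t y)) x
    = (5 * k1 / 3 + 5 * k2 / 2) * a ^ 3 * (3 * cusp s x - cusp s x ^ 3) / 8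
      + 3 * k3 / 2 * a\<^sup>2 * (2 * cusp s x - cusp s x ^ 2) / 3"
    by (intro conv_p_even conv_exists_source) (simp add: source1_peakon s_def)
  have sg: "(sgn (x - s)) ^ 3 = sgn (x - s)" by (simp add: sgn_real_def)
  have ux3: "peakon_x a c x0 t x ^ 3 = - (a ^ 3) * sgn (x - s) * cusp s x ^ 3"
    unfolding peakon_x_def s_def[symmetric] by (simp add: power_mult_distrib sg)
  have u: "peakon a c x0 t x = a * cusp s x" by (simp add: peakon_eq_cusp s_def)
  show ?thesis
    unfolding weak_integrand_def Let_def DERIV_imp_deriv[OF dt] DERIV_imp_deriv[OF dx] c0 c1 u ux3
    unfolding \<alpha>_def \<beta>_def c
    by (simp add: field_simps power3_eq_cube power2_eq_square)
qed

section \<open>Weak transport of a travelling profile\<close>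

text \<open>In coordinates attached to the crest the kink of the profile does not move. Hence the integral can be
  differentiated in time under the integral sign, with all derivatives falling on the smooth \<open>\<phi>\<close>.\<close>

lemma DERIV_integral_cusp_travelling:
  fixes \<phi> :: "real \<times> real \<Rightarrow> real"
  assumes \<phi>: "\<forall>k. Ck k \<phi>"
  shows "((\<lambda>t. integral {l..r} (\<lambda>y. cusp 0 y * \<phi> (t, y + (c * t + x0)))) has_real_derivative
          integral {l..r} (\<lambda>y. cusp 0 y * frechet_derivative \<phi> (at (t, y + (c * t + x0))) (1, c))) (at t)"
    and "continuous_on UNIV
          (\<lambda>t. integral {l..r} (\<lambda>y. cusp 0 y * frechet_derivative \<phi> (at (t, y + (c * t + x0))) (1, c)))"
proof -
  have cont: "continuous_on A (\<lambda>z. cusp 0 (snd z) * frechet_derivative \<phi> (at (fst z, snd z + (c * fst z + x0))) (1, c))" for A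
    by (intro continuous_intros continuous_on_compose2[OF continuous_cusp] continuous_on_compose2[OF smooth_differentiable(3)[OF \<phi>]]) auto
  then have cont': "continuous_on A (\<lambda>(t, y). cusp 0 y * frechet_derivative \<phi> (at (t, y + (c * t + x0))) (1, c))" for A
    by (simp add: case_prod_unfold)
  have D: "((\<lambda>t. cusp 0 y * \<phi> (t, y + (c * t + x0))) has_real_derivative
          cusp 0 y * frechet_derivative \<phi> (at (t, y + (c * t + x0))) (1, c)) (at t)" for t y
  proof -
    have "((\<lambda>t. (t, y + (c * t + x0))) has_vector_derivative (1, c)) (at t)"
      by (auto intro!: derivative_eq_intros simp: has_vector_derivative_def)
    from DERIV_cmult[OF frechet_derivative_along_curve[OF smooth_differentiable(1)[OF \<phi>] this]]
    show ?thesis .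
  qed
  have int: "(\<lambda>y. cusp 0 y * \<phi> (t, y + (c * t + x0))) integrable_on cbox l r" for t
    by (intro integrable_continuous continuous_intros continuous_on_compose2[OF smooth_differentiable(2)[OF \<phi>]]) auto
  show "((\<lambda>t. integral {l..r} (\<lambda>y. cusp 0 y * \<phi> (t, y + (c * t + x0)))) has_real_derivative
          integral {l..r} (\<lambda>y. cusp 0 y * frechet_derivative \<phi> (at (t, y + (c * t + x0))) (1, c))) (at t)"
    using leibniz_rule_field_derivative[where U=UNIV, OF D int cont'] by simp
  show "continuous_on UNIV
          (\<lambda>t. integral {l..r} (\<lambda>y. cusp 0 y * frechet_derivative \<phi> (at (t, y + (c * t + x0))) (1, c)))"
    using integral_continuous_on_param[where U=UNIV, OF cont'] by simp
qed

lemma lebesgue_integral_half_open: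
  fixes f :: "real \<Rightarrow> real"
  assumes "continuous_on {a..b} f"
  shows "integral\<^sup>L (lebesgue_on {a..<b}) f = integral {a..b} f"
proof -
  have "f absolutely_integrable_on {a..b}"
    by (rule absolutely_integrable_continuous_real[OF assms])
  then have "f absolutely_integrable_on {a..<b}"
    by (rule set_integrable_subset) auto
  then have "integrable (lebesgue_on {a..<b}) f"
    by (rule absolutely_integrable_imp_integrable) auto
  then have "(f has_integral integral\<^sup>L (lebesgue_on {a..<b}) f) {a..<b}"
    by (rule has_integral_integral_lebesgue_on) auto
  moreover have "{x \<in> {a..b} - {a..<b}. f x \<noteq> 0} \<subseteq> {b}" by auto
  ultimately have "(f has_integral integral\<^sup>L (lebesgue_on {a..<b}) f) {a..b}"
    by (subst (asm) has_integral_spike_set_eq[of _ "{a..b}"])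
      (auto intro: negligible_subset[OF negligible_sing])
  then show ?thesis by (simp add: integral_unique)
qed

text \<open>Like every function of \<open>x - c * t\<close>, the travelling cusp solves \<open>u\<^sub>t + c * u\<^sub>x = 0\<close> weakly. The
  inner integral is the time derivative of \<open>J t\<close>, the pairing of the profile with \<open>\<phi>\<close> at time \<open>t\<close>; so the double integral is \<open>J T - J 0\<close>, where
  \<open>J T = 0\<close> and \<open>J 0\<close> is the initial term.\<close>

lemma cusp_travelling_weak_transport:
  fixes \<phi> :: "real \<times> real \<Rightarrow> real"
  assumes T: "0 < T" and \<phi>: "\<forall>k. Ck k \<phi>" 
    and K: "compact K" "K \<subseteq> {0..<T} \<times> UNIV" "\<forall>z\<in>{0..<T} \<times> UNIV - K. \<phi> z = 0"
  shows "(LINT t|lebesgue_on {0..<T}. LINT x|lebesgue.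
            cusp (c * t + x0) x * frechet_derivative \<phi> (at (t, x)) (1, c))
          + (LINT x|lebesgue. cusp x0 x * \<phi> (0, x)) = 0"
proof -
  define D where "D z = frechet_derivative \<phi> (at z) (1, c)" for z
  have S: "closure (interior ({0..<T} \<times> UNIV)) = {0..T} \<times> (UNIV :: real set)"
    using T by (simp add: interior_Times closure_Times)
  have off: "\<phi> z = 0" "D z = 0" if "z \<in> {0..T} \<times> UNIV" "z \<notin> K" for z
    using vanishes_off_support[OF \<phi> compact_imp_closed[OF K(1)] K(3)] that S by (auto simp: D_def)
  obtain R where R: "\<And>t x. (t, x) \<in> K \<Longrightarrow> \<bar>x\<bar> \<le> R"
    using compact_bounds_second_coordinate[OF K(1)] by blast
  \<comment> \<open>A radius around the moving crest that covers the support of \<open>\<phi>\<close> at all times in \<open>[0,T]\<close>.\<close>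
  define R' where "R' = R + \<bar>c\<bar> * T + \<bar>x0\<bar>"
  have R': "R + \<bar>c * t + x0\<bar> \<le> R'" if "t \<in> {0..T}" for t
  proof -
    have "\<bar>c * t\<bar> \<le> \<bar>c\<bar> * T" using that by (auto simp: abs_mult intro!: mult_left_mono)
    then show ?thesis unfolding R'_def by linarith
  qed
  define J where "J t = integral {-R'..R'} (\<lambda>y. cusp 0 y * \<phi> (t, y + (c * t + x0)))" for t
  define J' where "J' t = integral {-R'..R'} (\<lambda>y. cusp 0 y * D (t, y + (c * t + x0)))" for t
  have shift: "cusp s (y + s) = cusp 0 y" for s y by (simp add: cusp_def)
  have inner: "(LINT x|lebesgue. cusp (c * t + x0) x * f (t, x))
      = integral {-R'..R'} (\<lambda>y. cusp 0 y * f (t, y + (c * t + x0)))"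
    if f: "continuous_on UNIV f" "\<And>z. z \<in> {0..T} \<times> UNIV \<Longrightarrow> z \<notin> K \<Longrightarrow> f z = 0" and t: "t \<in> {0..T}" for f t
  proof -
    have "continuous_on UNIV (\<lambda>x. cusp (c * t + x0) x * f (t, x))"
      by (intro continuous_intros continuous_on_compose2[OF f(1)]) auto
    moreover have "cusp (c * t + x0) x * f (t, x) = 0" if "R < \<bar>x\<bar>" for x
      using f(2)[of "(t, x)"] t R[of t x] that by fastforce
    ultimately show ?thesis
      using lebesgue_integral_shifted_interval[OF _ _ R'[OF t]] shift by simp
  qed
  have "(LINT t|lebesgue_on {0..<T}. LINT x|lebesgue. cusp (c * t + x0) x * D (t, x))
      = (LINT t|lebesgue_on {0..<T}. J' t)"
    unfolding J'_def
    by (intro Bochner_Integration.integral_cong inner)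
      (use off smooth_differentiable(3)[OF \<phi>] in \<open>auto simp: D_def\<close>)
  also have "\<dots> = integral {0..T} J'"
    unfolding J'_def D_def
    by (intro lebesgue_integral_half_open continuous_on_subset[OF DERIV_integral_cusp_travelling(2)[OF \<phi>]]) auto
  also have "\<dots> = J T - J 0"
  proof (intro integral_unique fundamental_theorem_of_calculus)
    show "(J has_vector_derivative J' t) (at t within {0..T})" for t
      unfolding has_real_derivative_iff_has_vector_derivative[symmetric] J_def J'_def D_def
      by (rule has_field_derivative_at_within[OF DERIV_integral_cusp_travelling(1)[OF \<phi>]])
  qed (use T in simp)
  also have "J T = 0"
  proof -
    have "(T, x) \<notin> K" for x using K(2) by auto
    then have "\<phi> (T, x) = 0" for x using off(1)[of "(T, x)"] T by simp
    then show ?thesis by (simp add: J_def)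
  qed
  also have "J 0 = (LINT x|lebesgue. cusp x0 x * \<phi> (0, x))"
    using inner[of \<phi> 0] off smooth_differentiable(2)[OF \<phi>] T by (simp add: J_def)
  finally show ?thesis by (simp add: D_def)
qed

section \<open>Peakons are global weak solutions\<close>

lemma weak_solution_peakon:
  assumes c: "c = (2 * k1 / 3 + k2) * a\<^sup>2 + k3 * a" and T: "0 < T"
  shows "weak_solution k1 k2 k3 T (peakon a c x0 0) (peakon a c x0)"
proof -
  define \<alpha> where "\<alpha> = (k1 / 8 + k2 / 48) * a ^ 3"
  define \<beta> where "\<beta> = - (k1 / 3 + k2 / 2) * a ^ 3 / 8"
  define G where "G t x = \<alpha> * cusp (c * t + x0) x ^ 3 + \<beta> * cusp (c * t + x0) x" for t x
  define G' where "G' t x = - sgn (x - (c * t + x0)) * (3 * \<alpha> * cusp (c * t + x0) x ^ 3 + \<beta> * cusp (c * t + x0) x)" for t x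
  let ?S = "{0..<T} \<times> (UNIV :: real set)"
  have bG: "\<bar>G t x\<bar> \<le> \<bar>\<alpha>\<bar> + \<bar>\<beta>\<bar>" for t x
    unfolding G_def by (rule order_trans[OF abs_triangle_ineq]) (auto simp: abs_mult intro!: add_mono mult_left_le power_le_one)
  have bG': "\<bar>G' t x\<bar> \<le> \<bar>3 * \<alpha>\<bar> + \<bar>\<beta>\<bar>" for t x
  proof -
    have "\<bar>3 * \<alpha> * cusp (c * t + x0) x ^ 3 + \<beta> * cusp (c * t + x0) x\<bar> \<le> \<bar>3 * \<alpha>\<bar> + \<bar>\<beta>\<bar>"
      by (rule order_trans[OF abs_triangle_ineq]) (auto simp: abs_mult intro!: add_mono mult_left_le power_le_one)
    then show ?thesis unfolding G'_def abs_mult by (auto simp: sgn_real_def)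
  qed
  have bu: "\<bar>a * cusp s x\<bar> \<le> \<bar>a\<bar>" for s x
    by (auto simp: abs_mult intro!: mult_left_le)
  have mG: "(\<lambda>z. G (fst z) (snd z)) \<in> borel_measurable borel" "(\<lambda>z. G' (fst z) (snd z)) \<in> borel_measurable borel"
    "(\<lambda>z. a * cusp (c * fst z + x0) (snd z)) \<in> borel_measurable borel"
    unfolding G_def G'_def cusp_def borel_prod[symmetric] by measurable
  have mG1: "G t \<in> borel_measurable borel" "G' t \<in> borel_measurable borel" for t
    unfolding G_def[abs_def] G'_def[abs_def] by simp_all
  have contG: "continuous_on UNIV (G t)" for t
    unfolding G_def[abs_def] by (intro continuous_intros)
  have DG: "(G t has_real_derivative G' t x) (at x)" if "x \<noteq> c * t + x0" for t x
    unfolding G_def[abs_def] G'_def using that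
    by (auto intro!: derivative_eq_intros cusp_deriv simp: algebra_simps power3_eq_cube power2_eq_square)
  have main: "integrable (lebesgue_on ?S) (\<lambda>(t, x). weak_integrand k1 k2 k3 (peakon a c x0) (peakon_x a c x0) \<phi> t x)
      \<and> (LINT t|lebesgue_on {0..<T}. LINT x|lebesgue. weak_integrand k1 k2 k3 (peakon a c x0) (peakon_x a c x0) \<phi> t x)
          + (LINT x|lebesgue. peakon a c x0 0 x * \<phi> (0, x)) = 0"
    if "\<phi> \<in> Cc_infinity ?S" for \<phi>
  proof -
    from that obtain K where \<phi>: "\<forall>k. Ck k \<phi>"
      and K: "compact K" "K \<subseteq> ?S" "\<forall>z\<in>?S - K. \<phi> z = 0"
      by (auto simp: Cc_infinity_def)
    define D where "D v z = frechet_derivative \<phi> (at z) v" for v z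
    note smooth = smooth_differentiable[OF \<phi>]
    have contD: "continuous_on UNIV (D v)" for v
      using smooth(3) by (simp add: D_def[abs_def])
    have "?S \<subseteq> closure (interior ?S)"
      using T by (auto simp: interior_Times closure_Times)
    then have "z \<in> closure (interior ?S)" "z \<notin> K" if "z \<in> ?S - K" for z
      using that by blast+
    note off = vanishes_off_support[OF \<phi> compact_imp_closed[OF K(1)] K(3) this, folded D_def]
    have dt: "((\<lambda>r. \<phi> (r, x)) has_real_derivative D (1, 0) (t, x)) (at t)" for t x
      unfolding D_def by (rule frechet_derivative_along_curve[OF smooth(1)])
        (auto intro!: derivative_eq_intros simp: has_vector_derivative_def)
    have dx: "((\<lambda>y. \<phi> (t, y)) has_real_derivative D (0, 1) (t, x)) (at x)" for t x
      unfolding D_def by (rule frechet_derivative_along_curve[OF smooth(1)])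
        (auto intro!: derivative_eq_intros simp: has_vector_derivative_def)
    have lin: "D (1, 0) z + c * D (0, 1) z = D (1, c) z" for z
    proof -
      note l = linear_frechet_derivative[OF smooth(1)[of z]]
      have "D (1, c) z = D ((1, 0) + c *\<^sub>R (0, 1)) z" by simp
      also have "\<dots> = D (1, 0) z + c * D (0, 1) z"
        unfolding D_def linear_add[OF l] linear_scale[OF l] real_scaleR_def ..
      finally show ?thesis ..
    qed
    have W: "weak_integrand k1 k2 k3 (peakon a c x0) (peakon_x a c x0) \<phi> t x
      = a * cusp (c * t + x0) x * D (1, c) (t, x) + (G t x * D (0, 1) (t, x) + G' t x * \<phi> (t, x))" for t x
      unfolding weak_integrand_peakon[OF c dt dx] lin G_def G'_def \<alpha>_def \<beta>_def ..
    have int: "integrable (lebesgue_on ?S) (\<lambda>(t, x). weak_integrand k1 k2 k3 (peakon a c x0) (peakon_x a c x0) \<phi> t x)"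
      unfolding W case_prod_unfold prod.collapse
      by (intro Bochner_Integration.integrable_add
          integrable_bounded_mult_compact_support[OF mG(3) bu contD K(1,2) off(2)]
          integrable_bounded_mult_compact_support[OF mG(1) bG contD K(1,2) off(2)]
          integrable_bounded_mult_compact_support[OF mG(2) bG' smooth(2) K(1,2) off(1)])
        (auto intro: borel_Times)
    obtain R where R: "\<And>t x. (t, x) \<in> K \<Longrightarrow> \<bar>x\<bar> \<le> R"
      using compact_bounds_second_coordinate[OF K(1)] by blast
    have inner: "(LINT x|lebesgue. weak_integrand k1 k2 k3 (peakon a c x0) (peakon_x a c x0) \<phi> t x)
        = a * (LINT x|lebesgue. cusp (c * t + x0) x * D (1, c) (t, x))" if t: "t \<in> {0..<T}" for t
    proof -
      have cont: "continuous_on UNIV (\<lambda>x. D v (t, x))" "continuous_on UNIV (\<lambda>x. \<phi> (t, x))" for v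
        by (intro continuous_on_compose2[OF contD] continuous_on_compose2[OF smooth(2)] continuous_intros; simp)+
      have 0: "D v (t, x) = 0" "\<phi> (t, x) = 0" if "R < \<bar>x\<bar>" for v x
        using off[of "(t, x)"] R[of t x] t that by fastforce+
      have i: "integrable lebesgue (\<lambda>x. a * cusp (c * t + x0) x * D (1, c) (t, x))"
        by (rule integrable_bounded_mult_bounded_support[OF _ bu cont(1) 0(1)]) auto
      have j: "integrable lebesgue (\<lambda>x. G t x * D (0, 1) (t, x) + G' t x * \<phi> (t, x))"
        by (intro Bochner_Integration.integrable_add
          integrable_bounded_mult_bounded_support[OF mG1(1) bG cont(1) 0(1)]
          integrable_bounded_mult_bounded_support[OF mG1(2) bG' cont(2) 0(2)])
      have "(LINT x|lebesgue. G t x * D (0, 1) (t, x) + G' t x * \<phi> (t, x)) = 0"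
        by (rule integration_by_parts_kink[OF contG DG dx 0(2) j])
      then show ?thesis
        unfolding W Bochner_Integration.integral_add[OF i j] by (simp add: mult.assoc)
    qed
    have "(LINT t|lebesgue_on {0..<T}. LINT x|lebesgue. weak_integrand k1 k2 k3 (peakon a c x0) (peakon_x a c x0) \<phi> t x)
        = (LINT t|lebesgue_on {0..<T}. a * (LINT x|lebesgue. cusp (c * t + x0) x * D (1, c) (t, x)))"
      by (intro Bochner_Integration.integral_cong inner) auto
    also have "\<dots> = a * (LINT t|lebesgue_on {0..<T}. LINT x|lebesgue. cusp (c * t + x0) x * D (1, c) (t, x))"
      by simp
    also have "\<dots> = - a * (LINT x|lebesgue. cusp x0 x * \<phi> (0, x))"
      unfolding D_def
        eq_neg_iff_add_eq_0[THEN iffD2, OF cusp_travelling_weak_transport[OF T \<phi> K, of c x0]]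
      by simp
    also have "\<dots> = - (LINT x|lebesgue. peakon a c x0 0 x * \<phi> (0, x))"
      by (simp add: peakon_eq_cusp mult.assoc)
    finally show ?thesis using int by simp
  qed
  show ?thesis
    unfolding weak_solution_def
  proof (intro conjI exI[of _ "peakon_x a c x0"] ballI AE_I2)
    fix \<phi> assume "\<phi> \<in> Cc_infinity ?S"
    note main[OF this]
    then show "integrable (lebesgue_on ?S) (\<lambda>(t, x). weak_integrand k1 k2 k3 (peakon a c x0) (peakon_x a c x0) \<phi> t x)"
      and "(LINT t|lebesgue_on {0..<T}. LINT x|lebesgue. weak_integrand k1 k2 k3 (peakon a c x0) (peakon_x a c x0) \<phi> t x)
          + (LINT x|lebesgue. peakon a c x0 0 x * \<phi> (0, x)) = 0"
      by (rule conjunct1, rule conjunct2)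
  qed (rule W13_peakon Linf_loc_W13_loc_peakon conv_exists_source)+
qed

theorem proposition1p1:
  fixes k1 k2 k3 a x0 c :: real
  assumes "a \<noteq> 0"
    and "c = (2 * k1 / 3 + k2) * a\<^sup>2 + k3 * a"
  shows "global_weak_solution k1 k2 k3 (peakon a c x0 0) (peakon a c x0)"
  unfolding global_weak_solution_def using weak_solution_peakon[OF assms(2)] by blast

end
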